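(* A two-sided Markov family $\{\Lambda^n\}_{n\ge 1}$ is uniquely determined by $\Lambda^1$. That is: if $\{\Lambda^n\}_{n\ge 1}$ and $\{\widetilde\Lambda^n\}_{n\ge 1}$ are two two-sided Markov families with $\Lambda^1_{a,b}=\widetilde\Lambda^1_{a,b}$ for all $a,b\in\mathbb{R}^+$, $a\ne b$, then $\Lambda^n_{a,b}=\widetilde\Lambda^n_{a,b}$ for all $n\ge 1$ and all $a,b\in\mathbb{R}^+$, $a\neq b$.
   Context: Notation: $\mathbb{R}^+=(0,\infty)$; for $a,b\in\mathbb{R}^+$, $I_{a,b}=(a\wedge b,a\vee b)$ where $\wedge$ is minimum and $\vee$ is maximum. Pairs of parameters $(a,b)$ are always taken with $a\neq b$. The support of a function $f$ is $\mathrm{supp}(f)=\{x: f(x)\neq 0\}$. Families: a family $\{\Lambda^n\}_{n\ge1}$ assigns to every $n\ge 1$ and every $a,b\in\mathbb{R}^+$, $a\ne b$, a Borel function $\Lambda^n_{a,b}:\mathbb{R}^n\to[0,\infty)$ which is a probability density (with respect to Lebesgue measure) of a random vector $(\Theta_1,\dots,\Theta_n)$ taking values in $(I_{a,b})^n$; it is taken to vanish outside $(I_{a,b})^n$. We set $\Lambda^0_{a,b}:=1$. The $i$-th marginal is $$\Lambda^{n,i}_{a,b}(\theta_i)=\int_{-\infty}^\infty\cdots\int_{-\infty}^\infty \Lambda^n_{a,b}(\theta_1,\dots,\theta_n)\,d\theta_1\cdots d\theta_{i-1}\,d\theta_{i+1}\cdots d\theta_n,$$ and for $\theta_i\in\mathrm{supp}(\Lambda^{n,i}_{a,b})$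 the conditional density is $\Lambda^n_{a,b}(\theta_1,\dots,\theta_n\mid\Theta_i=\theta_i):=\Lambda^n_{a,b}(\theta_1,\dots,\theta_n)/\Lambda^{n,i}_{a,b}(\theta_i)$. The family is two-sided Markov if for all $n\ge1$ and $a,b\in\mathbb{R}^+$: (i) $\Lambda^n_{a,b}(\theta_1,\dots,\theta_n\mid\Theta_j=\theta_j)=\Lambda^{j-1}_{a,\theta_j}(\theta_1,\dots,\theta_{j-1})\cdot\Lambda^{n-j}_{\theta_j,b}(\theta_{j+1},\dots,\theta_n)$ for all $1\le j\le n$ and all $\theta_1,\dots,\theta_n\in I_{a,b}$ (whenever the conditional density is defined); and (ii) $\mathrm{supp}(\Lambda^1_{a,b})=I_{a,b}$. *)

theory Defs
  imports "HOL-Probability.Probability"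
begin

text \<open>
  Points of \<open>\<real>\<^sup>n\<close> are functions \<open>nat \<Rightarrow> real\<close> that are extensional on the index set \<open>{1..n}\<close>,
  i.e. the elements of the space of the product measure below.
\<close>

abbreviation lebesgue_n :: "nat \<Rightarrow> (nat \<Rightarrow> real) measure" where
  "lebesgue_n n \<equiv> Pi\<^sub>M {1..n} (\<lambda>_. lborel)"

definition I :: "real \<Rightarrow> real \<Rightarrow> real set" where
  "I a b = {min a b <..< max a b}"

definition supp :: "('a \<Rightarrow> 'b::zero) \<Rightarrow> 'a set" where
  "supp f = {x. f x \<noteq> 0}"

text \<open>
  \<open>L n a b\<close> is the density with index \<open>n\<close> and parameters \<open>a\<close>, \<open>b\<close>. Only \<open>n \<ge> 1\<close>, distinct
  positive \<open>a\<close>, \<open>b\<close> and arguments in \<open>space (lebesgue_n n)\<close> are meaningful.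
\<close>

type_synonym fam = "nat \<Rightarrow> real \<Rightarrow> real \<Rightarrow> (nat \<Rightarrow> real) \<Rightarrow> real"

definition density_family :: "fam \<Rightarrow> bool" where
  "density_family L \<longleftrightarrow>
    (\<forall>n\<ge>1. \<forall>a>0. \<forall>b>0. a \<noteq> b \<longrightarrow>
      L n a b \<in> borel_measurable (lebesgue_n n) \<and>
      (\<forall>\<theta>\<in>space (lebesgue_n n). 0 \<le> L n a b \<theta>) \<and>
      prob_space (density (lebesgue_n n) (\<lambda>\<theta>. ennreal (L n a b \<theta>))) \<and>
      (\<forall>\<theta>\<in>space (lebesgue_n n). \<theta> \<notin> {1..n} \<rightarrow>\<^sub>E I a b \<longrightarrow> L n a b \<theta> = 0))"

text \<open>The convention that the density with index \<open>0\<close> is the constant \<open>1\<close>.\<close>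

definition dens :: "fam \<Rightarrow> fam" where
  "dens L n a b \<theta> = (if n = 0 then 1 else L n a b \<theta>)"

text \<open>
  The marginal is the integral of a nonnegative Borel function, hence takes values in
  \<open>[0, \<infinity>]\<close>. A point where it is infinite belongs to its support, and the conditional density
  there is a quotient by \<open>\<infinity>\<close>, i.e. \<open>0\<close>. The Markov property excludes such points, as the product
  on its right-hand side does not vanish identically.
\<close>

definition marginal :: "fam \<Rightarrow> nat \<Rightarrow> nat \<Rightarrow> real \<Rightarrow> real \<Rightarrow> real \<Rightarrow> ennreal" where
  "marginal L n i a b t =
    (\<integral>\<^sup>+ x. ennreal (L n a b (x(i := t))) \<partial>(Pi\<^sub>M ({1..n} - {i}) (\<lambda>_. lborel)))"

definition cond_density ::
  "fam \<Rightarrow> nat \<Rightarrow> nat \<Rightarrow> real \<Rightarrow> real \<Rightarrow> (nat \<Rightarrow> real) \<Rightarrow> ennreal" where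
  "cond_density L n i a b \<theta> = ennreal (L n a b \<theta>) / marginal L n i a b (\<theta> i)"

definition two_sided_Markov :: "fam \<Rightarrow> bool" where
  "two_sided_Markov L \<longleftrightarrow>
    (\<forall>n\<ge>1. \<forall>a>0. \<forall>b>0. a \<noteq> b \<longrightarrow>
      (\<forall>j\<in>{1..n}. \<forall>\<theta>\<in>{1..n} \<rightarrow>\<^sub>E I a b.
        \<theta> j \<in> supp (marginal L n j a b) \<longrightarrow>
        cond_density L n j a b \<theta> =
          ennreal (dens L (j - 1) a (\<theta> j) (\<lambda>i\<in>{1..j - 1}. \<theta> i) *
                   dens L (n - j) (\<theta> j) b (\<lambda>i\<in>{1..n - j}. \<theta> (j + i))))) \<and>
    (\<forall>a>0. \<forall>b>0. a \<noteq> b \<longrightarrow> supp (\<lambda>t. L 1 a b (\<lambda>i\<in>{1}. t)) = I a b)"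

end

theory Submission imports Defs begin

text \<open>
  The Markov property at the first coordinate says that \<open>L (n + 1) a b\<close> is the product of a
  function \<open>m\<close> of the first coordinate (its marginal) and an \<open>n\<close>-dimensional density of the family;
  at the last coordinate it says the same with a function \<open>q\<close> of the last coordinate. Suppose that
  \<open>L\<close> and \<open>L'\<close> agree in dimension \<open>n\<close>. Then the \<open>n\<close>-dimensional factors cancel in the quotient
  \<open>L' / L\<close> in dimension \<open>n + 1\<close>, which therefore depends on the first coordinate only and also on
  the last coordinate only. Any two points \<open>x\<close>, \<open>y\<close> of the interval with \<open>x\<close> nearer to \<open>a\<close> are the
  end coordinates of a common argument at which the densities do not vanish, so the quotient is
  constant, and normalisation makes it 1. This is \<open>dimension_step\<close>, and the theorem follows by
  induction on the dimension.

  Equality is claimed at every point and not just almost everywhere, while the Markov property gives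
  no information where a marginal vanishes. Most of the work thus goes into
  \<open>end_marginals_nonzero\<close>: the first and the last marginal vanish nowhere on the interval. It is
  proved together with \<open>all_positive_on_paths\<close>: the densities are positive at every tuple that moves
  strictly monotonically from \<open>a\<close> to \<open>b\<close>. In dimension 1 this is the assumption on the support. For
  the step, the first marginal has total mass 1, so it is nonzero on a set \<open>A\<close> of positive measure
  that stays away from \<open>b\<close>. The density is positive at monotone tuples starting in \<open>A\<close>, and those
  with a prescribed last coordinate near \<open>b\<close> contain a product of sets of positive measure; hence the
  last marginal is nonzero near \<open>b\<close>. The same argument run backwards gives that the first marginal is
  nonzero on the whole interval, and run forwards again that the last one is.
\<close>

section \<open>Open intervals and monotone tuples\<close>

text \<open>
  Monotonicity from \<open>a\<close> to \<open>b\<close> is expressed through \<open>I\<close>, which does not depend on the order of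
  its endpoints: a point comes later than \<open>x\<close> on the way from \<open>a\<close> to \<open>b\<close> iff it lies between \<open>x\<close> and
  \<open>b\<close>. This covers increasing (\<open>a < b\<close>) and decreasing (\<open>a > b\<close>) tuples at once.
\<close>

definition path :: "nat \<Rightarrow> real \<Rightarrow> real \<Rightarrow> (nat \<Rightarrow> real) set" where
  "path n a b = {\<theta> \<in> {1..n} \<rightarrow>\<^sub>E I a b. \<forall>i\<in>{1..n}. \<forall>j\<in>{1..n}. i < j \<longrightarrow> \<theta> j \<in> I (\<theta> i) b}"

definition positive_on_paths :: "fam \<Rightarrow> nat \<Rightarrow> bool" where
  "positive_on_paths L n \<longleftrightarrow> (\<forall>a>0. \<forall>b>0. a \<noteq> b \<longrightarrow> (\<forall>\<theta>\<in>path n a b. 0 < L n a b \<theta>))"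

lemma I_pos: "x \<in> I a b \<Longrightarrow> a > 0 \<Longrightarrow> b > 0 \<Longrightarrow> x > 0"
  by (auto simp: I_def min_def split: if_splits)

text \<open>
  Both sides say that \<open>a\<close>, \<open>x\<close>, \<open>y\<close>, \<open>b\<close> come in this order. The equivalence turns statements about
  what follows \<open>x\<close> into statements about what precedes \<open>y\<close>.
\<close>

lemma I_exchange: "x \<in> I a b \<and> y \<in> I x b \<longleftrightarrow> y \<in> I a b \<and> x \<in> I a y"
  by (auto simp: I_def min_def max_def split: if_splits)

lemma I_trans: "y \<in> I x b \<Longrightarrow> z \<in> I y b \<Longrightarrow> z \<in> I x b"
  by (auto simp: I_def min_def max_def split: if_splits)

lemma I_midpoint: "a \<noteq> b \<Longrightarrow> (a + b) / 2 \<in> I a b"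
  by (auto simp: I_def min_def max_def field_simps)

lemma I_distinct: "x \<in> I a b \<Longrightarrow> x \<noteq> a \<and> x \<noteq> b \<and> a \<noteq> b"
  by (auto simp: I_def)

lemma I_measurable [measurable]: "I a b \<in> sets borel"
  by (simp add: I_def)

lemma emeasure_I: "emeasure lborel (I a b) \<noteq> 0 \<longleftrightarrow> a \<noteq> b"
  by (auto simp: I_def min_def max_def)

text \<open>
  The cells lie between consecutive points of the sequence \<open>v - (v - u) / (k + 1)\<close>, which starts at
  \<open>u\<close> and moves strictly towards \<open>v\<close>. An infinite sequence serves all dimensions, without the
  bookkeeping of a partition into a given number of cells.
\<close>

lemma ordered_cells:
  assumes "u \<noteq> v"
  obtains B :: "nat \<Rightarrow> real set" where
    "\<And>k. B k \<in> sets borel" "\<And>k. emeasure lborel (B k) \<noteq> 0" "\<And>k. B k \<subseteq> I u v"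
    "\<And>i j s t. i < j \<Longrightarrow> s \<in> B i \<Longrightarrow> t \<in> B j \<Longrightarrow> t \<in> I s v"
proof -
  define p where "p k = v - (v - u) / real (Suc k)" for k
  \<comment> \<open>The factor \<open>v - u\<close> carries the direction, so that one estimate covers both orders of \<open>u\<close> and \<open>v\<close>.\<close>
  have p_mono: "(v - u) * p i \<le> (v - u) * p j" if "i \<le> j" for i j
  proof -
    have "(v - u)\<^sup>2 / real (Suc j) \<le> (v - u)\<^sup>2 / real (Suc i)"
      using that by (intro divide_left_mono) auto
    then show ?thesis
      by (simp add: p_def algebra_simps power2_eq_square)
  qed
  have p_dir: "if u < v then p i \<le> p j else p j \<le> p i" if "i \<le> j" for i j
    using p_mono[OF that] assms by (auto simp: mult_le_cancel_left)
  have p_strict: "p k \<noteq> p (Suc k)" for k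
    using assms by (auto simp: p_def field_simps)
  have p0: "p 0 = u"
    by (simp add: p_def)
  have pv: "if u < v then p k < v else v < p k" for k
    using assms by (auto simp: p_def divide_less_0_iff zero_less_divide_iff)
  show ?thesis
  proof (rule that[of "\<lambda>k. I (p k) (p (Suc k))"])
    show "emeasure lborel (I (p k) (p (Suc k))) \<noteq> 0" for k
      using p_strict emeasure_I by blast
    show "I (p k) (p (Suc k)) \<subseteq> I u v" for k
      using p_dir[of 0 k] p_dir[of k "Suc k"] pv[of "Suc k"] assms
      by (auto simp: p0 I_def min_def max_def split: if_splits)
    show "t \<in> I s v" if "i < j" "s \<in> I (p i) (p (Suc i))" "t \<in> I (p j) (p (Suc j))" for i j s t
      using that p_dir[of i "Suc i"] p_dir[of "Suc i" j] p_dir[of j "Suc j"] pv[of "Suc j"] assms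
      by (auto simp: I_def min_def max_def split: if_splits)
  qed simp
qed

lemma path_tail:
  assumes "\<theta> \<in> path (Suc n) a b"
  shows "(\<lambda>i\<in>{1..n}. \<theta> (1 + i)) \<in> path n (\<theta> 1) b"
proof -
  have "\<theta> j \<in> I (\<theta> i) b" if "i < j" "1 \<le> i" "j \<le> Suc n" for i j
    using assms that by (auto simp: path_def)
  then show ?thesis
    by (auto simp: path_def)
qed

lemma path_front:
  assumes "\<theta> \<in> path (Suc n) a b"
  shows "(\<lambda>i\<in>{1..n}. \<theta> i) \<in> path n a (\<theta> (Suc n))"
proof -
  have *: "\<theta> j \<in> I (\<theta> i) b" if "i < j" "1 \<le> i" "j \<le> Suc n" for i j
    using assms that by (auto simp: path_def)
  have **: "\<theta> i \<in> I a b" if "1 \<le> i" "i \<le> Suc n" for i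
    using assms that by (auto simp: path_def PiE_def Pi_def)
  have 1: "\<theta> i \<in> I a (\<theta> (Suc n))" if "1 \<le> i" "i \<le> n" for i
    using *[of i "Suc n"] **[of i] I_exchange that by auto
  have 2: "\<theta> j \<in> I (\<theta> i) (\<theta> (Suc n))" if "i < j" "1 \<le> i" "j \<le> n" for i j
    using *[of i j] *[of j "Suc n"] I_exchange that by auto
  show ?thesis
    using 1 2 by (auto simp: path_def)
qed

text \<open>
  The point \<open>z\<close> separates the first coordinate from the cells that hold the middle ones. The first
  coordinate is thus free to vary in a set as irregular as the region where a marginal is nonzero.
\<close>

lemma path_through_cells:
  assumes "n \<ge> 1" "z \<in> I a b" "y \<in> I z b"
    and \<theta>: "\<theta> \<in> extensional {1..Suc n}" "\<theta> 1 \<in> I a z" "\<theta> (Suc n) = y"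
      "\<And>i. 1 < i \<Longrightarrow> i \<le> n \<Longrightarrow> \<theta> i \<in> B i"
    and B: "\<And>k. B k \<subseteq> I z y"
      "\<And>i j s t. i < j \<Longrightarrow> s \<in> B i \<Longrightarrow> t \<in> B j \<Longrightarrow> t \<in> I s y"
  shows "\<theta> \<in> path (Suc n) a b"
proof -
  have first: "\<theta> 1 \<in> I a b" "z \<in> I (\<theta> 1) b"
    using I_exchange \<theta>(2) assms(2) by blast+
  have y: "y \<in> I a b"
    using I_trans assms(2,3) by blast
  have mid: "\<theta> i \<in> I z b" "\<theta> i \<in> I z y" "\<theta> i \<in> I a b" "y \<in> I (\<theta> i) b" if "1 < i" "i \<le> n" for i
    using \<theta>(4)[OF that] B(1)[of i] I_exchange assms(2,3) I_trans by blast+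
  have 1: "\<theta> i \<in> I a b" if i: "1 \<le> i" "i \<le> Suc n" for i
  proof -
    consider "i = 1" | "i = Suc n" | "1 < i" "i \<le> n" using i by linarith
    then show ?thesis using first y mid \<theta>(3) by cases auto
  qed
  have 2: "\<theta> j \<in> I (\<theta> i) b" if ij: "i < j" "1 \<le> i" "j \<le> Suc n" for i j
  proof -
    consider "i = 1" "j = Suc n" | "i = 1" "1 < j" "j \<le> n" | "1 < i" "i \<le> n" "j = Suc n"
      | "1 < i" "i \<le> n" "1 < j" "j \<le> n"
      using ij by linarith
    then show ?thesis
    proof cases
      case 1
      then show ?thesis using first assms(3) I_trans \<theta>(3) by metis
    next
      case 2
      then show ?thesis using first mid(1)[of j] I_trans by metis
    next
      case 3
      then show ?thesis using mid(4) \<theta>(3) by metis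
    next
      case 4
      then show ?thesis using B(2)[OF ij(1)] \<theta>(4) mid I_exchange by metis
    qed
  qed
  show ?thesis
    using \<theta>(1) 1 2 by (auto simp: path_def PiE_def)
qed

lemma path_exists:
  assumes "n \<ge> 1" "x \<in> I a b" "y \<in> I x b"
  obtains \<theta> where "\<theta> \<in> path (Suc n) a b" "\<theta> 1 = x" "\<theta> (Suc n) = y"
proof -
  define z where "z = (x + y) / 2"
  have z: "z \<in> I x y"
    unfolding z_def using I_midpoint I_distinct assms(3) by metis
  have zb: "y \<in> I z b" "z \<in> I a b" "x \<in> I a z"
    using z assms I_exchange I_trans by metis+
  have "z \<noteq> y" using z I_distinct by metis
  then obtain B :: "nat \<Rightarrow> real set" where B: "\<And>k. emeasure lborel (B k) \<noteq> 0" "\<And>k. B k \<subseteq> I z y"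
    "\<And>i j s t. i < j \<Longrightarrow> s \<in> B i \<Longrightarrow> t \<in> B j \<Longrightarrow> t \<in> I s y"
    by (rule ordered_cells) blast
  have "\<exists>t. t \<in> B k" for k
    using B(1)[of k] by (metis emeasure_empty equals0I)
  then obtain m where m: "\<And>k. m k \<in> B k"
    by metis
  define \<theta> where "\<theta> = (\<lambda>i\<in>{1..Suc n}. if i = 1 then x else if i = Suc n then y else m i)"
  have "\<theta> \<in> path (Suc n) a b"
    by (rule path_through_cells[OF assms(1) zb(2,1) _ _ _ _ B(2,3)])
      (use assms zb m in \<open>auto simp: \<theta>_def\<close>)
  with that show ?thesis
    using assms(1) by (auto simp: \<theta>_def)
qed

section \<open>Factorisation at the first and at the last coordinate\<close>

lemma density_familyD:
  assumes "density_family L" "n \<ge> 1" "a > 0" "b > 0" "a \<noteq> b"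
  shows "L n a b \<in> borel_measurable (lebesgue_n n)"
    "\<theta> \<in> extensional {1..n} \<Longrightarrow> 0 \<le> L n a b \<theta>"
    "(\<integral>\<^sup>+\<theta>. ennreal (L n a b \<theta>) \<partial>lebesgue_n n) = 1"
    "\<theta> \<in> extensional {1..n} \<Longrightarrow> \<theta> \<notin> {1..n} \<rightarrow>\<^sub>E I a b \<Longrightarrow> L n a b \<theta> = 0"
proof -
  have *: "L n a b \<in> borel_measurable (lebesgue_n n)"
     "(\<forall>\<theta>\<in>space (lebesgue_n n). 0 \<le> L n a b \<theta>)"
     "prob_space (density (lebesgue_n n) (\<lambda>\<theta>. ennreal (L n a b \<theta>)))"
     "(\<forall>\<theta>\<in>space (lebesgue_n n). \<theta> \<notin> {1..n} \<rightarrow>\<^sub>E I a b \<longrightarrow> L n a b \<theta> = 0)"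
    using assms unfolding density_family_def by blast+
  show "L n a b \<in> borel_measurable (lebesgue_n n)" by fact
  show "\<theta> \<in> extensional {1..n} \<Longrightarrow> 0 \<le> L n a b \<theta>"
    "\<theta> \<in> extensional {1..n} \<Longrightarrow> \<theta> \<notin> {1..n} \<rightarrow>\<^sub>E I a b \<Longrightarrow> L n a b \<theta> = 0"
    using *(2,4) by (auto simp: space_PiM PiE_def)
  have "emeasure (density (lebesgue_n n) (\<lambda>\<theta>. ennreal (L n a b \<theta>))) (space (lebesgue_n n)) = 1"
    using prob_space.emeasure_space_1[OF *(3)] by simp
  moreover have "emeasure (density (lebesgue_n n) (\<lambda>\<theta>. ennreal (L n a b \<theta>))) (space (lebesgue_n n))
     = (\<integral>\<^sup>+\<theta>. ennreal (L n a b \<theta>) * indicator (space (lebesgue_n n)) \<theta> \<partial>lebesgue_n n)"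
    using *(1) by (subst emeasure_density) auto
  moreover have "\<dots> = (\<integral>\<^sup>+\<theta>. ennreal (L n a b \<theta>) \<partial>lebesgue_n n)"
    by (intro nn_integral_cong) simp
  ultimately show "(\<integral>\<^sup>+\<theta>. ennreal (L n a b \<theta>) \<partial>lebesgue_n n) = 1" by simp
qed

text \<open>
  A conditional density determines the density itself, up to the value of the marginal, once the
  marginal is known to be neither zero nor infinite.
\<close>

lemma ennreal_quotient_eq:
  assumes "ennreal x / m = ennreal k" "0 \<le> x" "0 \<le> k" "m \<noteq> 0" "m \<noteq> \<top>"
  shows "x = enn2real m * k"
proof (cases m)
  case (real r)
  with assms have "r > 0" by (cases "r = 0") auto
  with real assms have "ennreal (x / r) = ennreal k"
    by (simp add: divide_ennreal)
  then show ?thesis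
    using \<open>r > 0\<close> assms real by (simp add: divide_eq_eq mult.commute)
qed (use assms in simp)

lemma Markov_first:
  assumes "two_sided_Markov L" "n \<ge> 1" "a > 0" "b > 0" "a \<noteq> b"
    "\<theta> \<in> {1..Suc n} \<rightarrow>\<^sub>E I a b" "marginal L (Suc n) 1 a b (\<theta> 1) \<noteq> 0"
  shows "ennreal (L (Suc n) a b \<theta>) / marginal L (Suc n) 1 a b (\<theta> 1)
    = ennreal (L n (\<theta> 1) b (\<lambda>i\<in>{1..n}. \<theta> (1 + i)))"
proof -
  have "cond_density L (Suc n) 1 a b \<theta> =
          ennreal (dens L (1 - 1) a (\<theta> 1) (\<lambda>i\<in>{1..1 - 1}. \<theta> i) *
                   dens L (Suc n - 1) (\<theta> 1) b (\<lambda>i\<in>{1..Suc n - 1}. \<theta> (1 + i)))"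
    using assms(1)[unfolded two_sided_Markov_def, THEN conjunct1, rule_format, of "Suc n" a b 1 \<theta>] assms
    by (simp add: supp_def)
  then show ?thesis
    using assms(2) by (simp add: cond_density_def dens_def)
qed

lemma Markov_last:
  assumes "two_sided_Markov L" "n \<ge> 1" "a > 0" "b > 0" "a \<noteq> b"
    "\<theta> \<in> {1..Suc n} \<rightarrow>\<^sub>E I a b" "marginal L (Suc n) (Suc n) a b (\<theta> (Suc n)) \<noteq> 0"
  shows "ennreal (L (Suc n) a b \<theta>) / marginal L (Suc n) (Suc n) a b (\<theta> (Suc n))
    = ennreal (L n a (\<theta> (Suc n)) (\<lambda>i\<in>{1..n}. \<theta> i))"
proof -
  have "cond_density L (Suc n) (Suc n) a b \<theta> =
          ennreal (dens L (Suc n - 1) a (\<theta> (Suc n)) (\<lambda>i\<in>{1..Suc n - 1}. \<theta> i) *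
                   dens L (Suc n - Suc n) (\<theta> (Suc n)) b (\<lambda>i\<in>{1..Suc n - Suc n}. \<theta> (Suc n + i)))"
    using assms(1)[unfolded two_sided_Markov_def, THEN conjunct1, rule_format, of "Suc n" a b "Suc n" \<theta>] assms
    by (simp add: supp_def)
  then show ?thesis
    using assms(2) by (simp add: cond_density_def dens_def)
qed

text \<open>
  The marginal is finite here because the quotient by an infinite marginal is 0 at every point, while
  the density on the other side of the Markov property is positive along a path that starts at the
  given first coordinate.
\<close>

lemma factor_first:
  assumes L: "density_family L" "two_sided_Markov L" "positive_on_paths L n"
    and n: "n \<ge> 1" and ab: "a > 0" "b > 0" "a \<noteq> b"
    and \<theta>: "\<theta> \<in> {1..Suc n} \<rightarrow>\<^sub>E I a b" and nz: "marginal L (Suc n) 1 a b (\<theta> 1) \<noteq> 0"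
  shows "0 < enn2real (marginal L (Suc n) 1 a b (\<theta> 1))"
    "L (Suc n) a b \<theta> = enn2real (marginal L (Suc n) 1 a b (\<theta> 1)) *
       L n (\<theta> 1) b (\<lambda>i\<in>{1..n}. \<theta> (1 + i))"
proof -
  let ?m = "marginal L (Suc n) 1 a b (\<theta> 1)"
  have in_I: "\<theta> 1 \<in> I a b" using \<theta> by (auto simp: PiE_def)
  then have "\<theta> 1 > 0" "\<theta> 1 \<noteq> b" using ab I_pos I_distinct by blast+
  then obtain \<eta> where \<eta>: "\<eta> \<in> path (Suc n) a b" "\<eta> 1 = \<theta> 1"
    using path_exists[OF n in_I I_midpoint] by metis
  have "0 < L n (\<theta> 1) b (\<lambda>i\<in>{1..n}. \<eta> (1 + i))"
    using L(3) path_tail[OF \<eta>(1)] \<eta>(2) \<open>\<theta> 1 > 0\<close> \<open>\<theta> 1 \<noteq> b\<close> ab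
    unfolding positive_on_paths_def by metis
  moreover have "ennreal (L (Suc n) a b \<eta>) / ?m = ennreal (L n (\<theta> 1) b (\<lambda>i\<in>{1..n}. \<eta> (1 + i)))"
    using Markov_first[OF L(2) n ab, of \<eta>] nz \<eta> by (simp add: path_def)
  ultimately have fin: "?m \<noteq> \<top>"
    by (auto simp: divide_ennreal_def)
  then show "0 < enn2real ?m"
    using nz by (simp add: enn2real_positive_iff top.not_eq_extremum zero_less_iff_neq_zero)
  show "L (Suc n) a b \<theta> = enn2real ?m * L n (\<theta> 1) b (\<lambda>i\<in>{1..n}. \<theta> (1 + i))"
  proof (rule ennreal_quotient_eq[OF Markov_first[OF L(2) n ab \<theta> nz] _ _ nz fin])
    show "0 \<le> L (Suc n) a b \<theta>"
      using density_familyD(2)[OF L(1) _ ab] \<theta> by (simp add: PiE_def)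
    show "0 \<le> L n (\<theta> 1) b (\<lambda>i\<in>{1..n}. \<theta> (1 + i))"
      using density_familyD(2)[OF L(1) n \<open>\<theta> 1 > 0\<close> ab(2) \<open>\<theta> 1 \<noteq> b\<close>] by simp
  qed
qed

lemma factor_last:
  assumes L: "density_family L" "two_sided_Markov L" "positive_on_paths L n"
    and n: "n \<ge> 1" and ab: "a > 0" "b > 0" "a \<noteq> b"
    and \<theta>: "\<theta> \<in> {1..Suc n} \<rightarrow>\<^sub>E I a b"
    and nz: "marginal L (Suc n) (Suc n) a b (\<theta> (Suc n)) \<noteq> 0"
  shows "0 < enn2real (marginal L (Suc n) (Suc n) a b (\<theta> (Suc n)))"
    "L (Suc n) a b \<theta> = enn2real (marginal L (Suc n) (Suc n) a b (\<theta> (Suc n))) *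
       L n a (\<theta> (Suc n)) (\<lambda>i\<in>{1..n}. \<theta> i)"
proof -
  let ?y = "\<theta> (Suc n)"
  let ?m = "marginal L (Suc n) (Suc n) a b ?y"
  have in_I: "?y \<in> I a b" using \<theta> by (auto simp: PiE_def)
  then have y: "?y > 0" "a \<noteq> ?y" using ab I_pos I_distinct by blast+
  then have "(a + ?y) / 2 \<in> I a b" "?y \<in> I ((a + ?y) / 2) b"
    using I_exchange I_midpoint in_I by blast+
  then obtain \<eta> where \<eta>: "\<eta> \<in> path (Suc n) a b" "\<eta> (Suc n) = ?y"
    using path_exists[OF n] by metis
  have "0 < L n a ?y (\<lambda>i\<in>{1..n}. \<eta> i)"
    using L(3) path_front[OF \<eta>(1)] \<eta>(2) y ab
    unfolding positive_on_paths_def by metis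
  moreover have "ennreal (L (Suc n) a b \<eta>) / ?m = ennreal (L n a ?y (\<lambda>i\<in>{1..n}. \<eta> i))"
    using Markov_last[OF L(2) n ab, of \<eta>] nz \<eta> by (simp add: path_def)
  ultimately have fin: "?m \<noteq> \<top>"
    by (auto simp: divide_ennreal_def)
  then show "0 < enn2real ?m"
    using nz by (simp add: enn2real_positive_iff top.not_eq_extremum zero_less_iff_neq_zero)
  show "L (Suc n) a b \<theta> = enn2real ?m * L n a ?y (\<lambda>i\<in>{1..n}. \<theta> i)"
  proof (rule ennreal_quotient_eq[OF Markov_last[OF L(2) n ab \<theta> nz] _ _ nz fin])
    show "0 \<le> L (Suc n) a b \<theta>"
      using density_familyD(2)[OF L(1) _ ab] \<theta> by (simp add: PiE_def)
    show "0 \<le> L n a ?y (\<lambda>i\<in>{1..n}. \<theta> i)"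
      using density_familyD(2)[OF L(1) n ab(1) y] by simp
  qed
qed

section \<open>Marginals as iterated integrals\<close>

lemma measurable_insert_coordinate:
  assumes "i \<in> {1..n}"
  shows "(\<lambda>(t, x). x(i := t)) \<in> lborel \<Otimes>\<^sub>M Pi\<^sub>M ({1..n} - {i}) (\<lambda>_. lborel) \<rightarrow>\<^sub>M lebesgue_n n"
  unfolding case_prod_beta
  using assms by (intro measurable_fun_upd[where J="{1..n} - {i}"]) auto

lemma marginal_measurable:
  assumes "L n a b \<in> borel_measurable (lebesgue_n n)" "i \<in> {1..n}"
  shows "marginal L n i a b \<in> borel_measurable borel"
proof -
  interpret product_sigma_finite "\<lambda>_. lborel" by standard
  interpret finite_product_sigma_finite "\<lambda>_. lborel" "{1..n} - {i}" by standard simp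
  have "(\<lambda>(t, x). ennreal (L n a b (x(i := t)))) \<in>
      borel_measurable (lborel \<Otimes>\<^sub>M Pi\<^sub>M ({1..n} - {i}) (\<lambda>_. lborel))"
    using measurable_compose[OF measurable_insert_coordinate[OF assms(2)] assms(1)]
    by (simp add: case_prod_beta)
  then have "(\<lambda>t. \<integral>\<^sup>+ x. ennreal (L n a b (x(i := t))) \<partial>Pi\<^sub>M ({1..n} - {i}) (\<lambda>_. lborel))
      \<in> borel_measurable lborel"
    by (rule borel_measurable_nn_integral)
  then show ?thesis
    by (simp add: marginal_def[abs_def])
qed

lemma nn_integral_marginal:
  assumes "L n a b \<in> borel_measurable (lebesgue_n n)" "i \<in> {1..n}"
  shows "(\<integral>\<^sup>+t. marginal L n i a b t \<partial>lborel) = (\<integral>\<^sup>+\<theta>. ennreal (L n a b \<theta>) \<partial>lebesgue_n n)"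
proof -
  interpret product_sigma_finite "\<lambda>_::nat. lborel :: real measure" by standard
  have i: "insert i ({1..n} - {i}) = {1..n}" using assms(2) by auto
  show ?thesis
    using product_nn_integral_insert_rev[of "{1..n} - {i}" i "\<lambda>\<theta>. ennreal (L n a b \<theta>)"] assms(1)
    unfolding i by (simp add: marginal_def)
qed

text \<open>
  A nonnegative integrand with zero integral vanishes almost everywhere, but a product of finitely
  many sets of positive measure is not a null set.
\<close>

lemma marginal_nonzero_box:
  assumes "L n a b \<in> borel_measurable (lebesgue_n n)" "i \<in> {1..n}"
    and B: "\<And>k. k \<in> {1..n} - {i} \<Longrightarrow> B k \<in> sets borel"
      "\<And>k. k \<in> {1..n} - {i} \<Longrightarrow> emeasure lborel (B k) \<noteq> 0"
    and pos: "\<And>x. x \<in> Pi\<^sub>E ({1..n} - {i}) B \<Longrightarrow> 0 < L n a b (x(i := t))"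
  shows "marginal L n i a b t \<noteq> 0"
proof
  assume 0: "marginal L n i a b t = 0"
  interpret product_sigma_finite "\<lambda>_::nat. lborel :: real measure" by standard
  let ?M = "Pi\<^sub>M ({1..n} - {i}) (\<lambda>_. lborel :: real measure)"
  have "(\<lambda>x. (t, x)) \<in> ?M \<rightarrow>\<^sub>M lborel \<Otimes>\<^sub>M ?M" by simp
  from measurable_compose[OF this measurable_insert_coordinate[OF assms(2)]]
  have "(\<lambda>x. x(i := t)) \<in> ?M \<rightarrow>\<^sub>M lebesgue_n n" by simp
  from measurable_compose[OF this assms(1)]
  have "(\<lambda>x. ennreal (L n a b (x(i := t)))) \<in> borel_measurable ?M" by simp
  with 0 have ae: "AE x in ?M. ennreal (L n a b (x(i := t))) = 0"
    by (simp add: marginal_def nn_integral_0_iff_AE del: One_nat_def)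
  then have "AE x in ?M. x \<notin> Pi\<^sub>E ({1..n} - {i}) B"
  proof eventually_elim
    case (elim x)
    then show ?case using pos[of x] by (auto simp: ennreal_eq_0_iff)
  qed
  moreover have "Pi\<^sub>E ({1..n} - {i}) B \<in> sets ?M"
    using B(1) by (intro sets_PiM_I_finite) auto
  ultimately have "emeasure ?M (Pi\<^sub>E ({1..n} - {i}) B) = 0"
    by (subst (asm) AE_iff_measurable[where N="Pi\<^sub>E ({1..n} - {i}) B"])
      (auto dest: sets.sets_into_space)
  moreover have "emeasure ?M (Pi\<^sub>E ({1..n} - {i}) B) = (\<Prod>k\<in>{1..n} - {i}. emeasure lborel (B k))"
    using B(1) by (intro emeasure_PiM) auto
  ultimately show False using B(2) by auto
qed

section \<open>The end marginals do not vanish\<close>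

text \<open>
  The set \<open>A\<close> and cells between \<open>z\<close> and \<open>y\<close> are the sides of a box of paths ending in \<open>y\<close>. On it
  the factorisation at the first coordinate is available, since the first marginal is nonzero on \<open>A\<close>.
\<close>

lemma last_marginal_nonzero:
  assumes L: "density_family L" "two_sided_Markov L" "positive_on_paths L n"
    and n: "n \<ge> 1" and ab: "a > 0" "b > 0" "a \<noteq> b"
    and A: "A \<in> sets borel" "emeasure lborel A \<noteq> 0" "A \<subseteq> I a z"
      "\<And>x. x \<in> A \<Longrightarrow> marginal L (Suc n) 1 a b x \<noteq> 0"
    and z: "z \<in> I a b" and y: "y \<in> I z b"
  shows "marginal L (Suc n) (Suc n) a b y \<noteq> 0"
proof -
  have "z \<noteq> y" using y I_distinct by metis
  then obtain B :: "nat \<Rightarrow> real set" where B: "\<And>k. B k \<in> sets borel"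
    "\<And>k. emeasure lborel (B k) \<noteq> 0" "\<And>k. B k \<subseteq> I z y"
    "\<And>i j s t. i < j \<Longrightarrow> s \<in> B i \<Longrightarrow> t \<in> B j \<Longrightarrow> t \<in> I s y"
    by (rule ordered_cells) blast
  show ?thesis
  proof (rule marginal_nonzero_box[where B="B(1 := A)"])
    show "L (Suc n) a b \<in> borel_measurable (lebesgue_n (Suc n))"
      using density_familyD(1)[OF L(1) _ ab] by simp
    fix x assume x: "x \<in> Pi\<^sub>E ({1..Suc n} - {Suc n}) (B(1 := A))"
    let ?\<theta> = "x(Suc n := y)"
    have x1: "?\<theta> 1 \<in> A" using x n by (auto simp: PiE_def Pi_def)
    have p: "?\<theta> \<in> path (Suc n) a b"
    proof (rule path_through_cells[OF n z y _ _ _ _ B(3,4)])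
      show "?\<theta> \<in> extensional {1..Suc n}"
        using x by (auto simp: PiE_def extensional_def)
      show "?\<theta> 1 \<in> I a z" using x1 A(3) by blast
      show "?\<theta> i \<in> B i" if "1 < i" "i \<le> n" for i
        using PiE_mem[OF x, of i] that by auto
    qed simp_all
    have \<theta>: "?\<theta> \<in> {1..Suc n} \<rightarrow>\<^sub>E I a b" using p by (simp add: path_def)
    have "?\<theta> 1 \<in> I a b" by (rule PiE_mem[OF \<theta>]) auto
    then have "0 < L n (?\<theta> 1) b (\<lambda>i\<in>{1..n}. ?\<theta> (1 + i))"
      using L(3) path_tail[OF p] I_pos I_distinct ab unfolding positive_on_paths_def by metis
    then show "0 < L (Suc n) a b ?\<theta>"
      using factor_first[OF L n ab \<theta> A(4)[OF x1]] by (metis mult_pos_pos)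
  qed (use A B in auto)
qed

text \<open>
  All the remaining coordinates, the last one included, range over cells between \<open>z\<close> and \<open>b\<close>, where
  the last marginal is nonzero and the factorisation at the last coordinate is available.
\<close>

lemma first_marginal_nonzero:
  assumes L: "density_family L" "two_sided_Markov L" "positive_on_paths L n"
    and n: "n \<ge> 1" and ab: "a > 0" "b > 0" "a \<noteq> b"
    and z: "z \<in> I a b" and nz: "\<And>y. y \<in> I z b \<Longrightarrow> marginal L (Suc n) (Suc n) a b y \<noteq> 0"
    and x: "x \<in> I a z"
  shows "marginal L (Suc n) 1 a b x \<noteq> 0"
proof -
  have xz: "x \<in> I a b" "z \<in> I x b" using x z I_exchange by blast+
  have "z \<noteq> b" using z I_distinct by metis
  then obtain B :: "nat \<Rightarrow> real set" where B: "\<And>k. B k \<in> sets borel"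
    "\<And>k. emeasure lborel (B k) \<noteq> 0" "\<And>k. B k \<subseteq> I z b"
    "\<And>i j s t. i < j \<Longrightarrow> s \<in> B i \<Longrightarrow> t \<in> B j \<Longrightarrow> t \<in> I s b"
    by (rule ordered_cells) blast
  show ?thesis
  proof (rule marginal_nonzero_box[where B=B])
    show "L (Suc n) a b \<in> borel_measurable (lebesgue_n (Suc n))"
      using density_familyD(1)[OF L(1) _ ab] by simp
    fix w assume w: "w \<in> Pi\<^sub>E ({1..Suc n} - {1}) B"
    let ?\<theta> = "w(1 := x)"
    have cell: "w i \<in> B i" if "1 < i" "i \<le> Suc n" for i
      using w that by (auto simp: PiE_def Pi_def)
    have mid: "w i \<in> I z b" "w i \<in> I x b" "w i \<in> I a b" if "1 < i" "i \<le> Suc n" for i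
      using cell[OF that] B(3)[of i] xz I_trans z by blast+
    have \<theta>: "?\<theta> \<in> {1..Suc n} \<rightarrow>\<^sub>E I a b"
      using w xz mid by (auto simp: PiE_def extensional_def)
    have "?\<theta> j \<in> I (?\<theta> i) b" if "i < j" "1 \<le> i" "j \<le> Suc n" for i j
      using that mid(2)[of j] B(4)[OF that(1) cell cell] by (cases "i = 1") auto
    with \<theta> have p: "?\<theta> \<in> path (Suc n) a b" by (auto simp: path_def)
    have last: "?\<theta> (Suc n) \<in> I z b" using mid n by auto
    then have "?\<theta> (Suc n) \<in> I a b" using z I_trans by blast
    then have "0 < L n a (?\<theta> (Suc n)) (\<lambda>i\<in>{1..n}. ?\<theta> i)"
      using L(3) path_front[OF p] I_pos I_distinct ab unfolding positive_on_paths_def by metis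
    then show "0 < L (Suc n) a b ?\<theta>"
      using factor_last[OF L n ab \<theta> nz[OF last]] by (metis mult_pos_pos)
  qed (use B in auto)
qed

text \<open>
  The marginal integrates to 1 and vanishes outside the interval, so it is nonzero on a set of
  positive measure. To keep this set away from \<open>b\<close>, the interval is exhausted by the intervals between
  \<open>a\<close> and a sequence of points tending to \<open>b\<close>; they cannot all meet the set in null sets.
\<close>

lemma first_marginal_support_mass:
  assumes L: "density_family L" and n: "n \<ge> 1" and ab: "a > 0" "b > 0" "a \<noteq> b"
  obtains z A where "z \<in> I a b" "A \<in> sets borel" "A \<subseteq> I a z" "emeasure lborel A \<noteq> 0"
    "\<And>x. x \<in> A \<Longrightarrow> marginal L n 1 a b x \<noteq> 0"
proof -
  let ?m = "marginal L n 1 a b"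
  have meas: "L n a b \<in> borel_measurable (lebesgue_n n)"
    by (rule density_familyD[OF L n ab])
  have [measurable]: "?m \<in> borel_measurable borel"
    using n by (intro marginal_measurable meas) auto
  have outside: "?m x = 0" if "x \<notin> I a b" for x
  proof -
    have "L n a b (w(1 := x)) = 0" if "w \<in> space (Pi\<^sub>M ({1..n} - {1}) (\<lambda>_. lborel))" for w
      using that \<open>x \<notin> I a b\<close> n
      by (intro density_familyD(4)[OF L n ab])
        (auto simp: space_PiM PiE_def extensional_def Pi_def)
    then show ?thesis by (simp add: marginal_def nn_integral_cong[where v="\<lambda>_. 0"])
  qed
  \<comment> \<open>The denominator starts at 2, so that \<open>z 0\<close> differs from \<open>a\<close>.\<close>
  define z where "z k = b - (b - a) / real (k + 2)" for k
  have z: "z k \<in> I a b" for k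
  proof -
    have "a < b \<Longrightarrow> a * real k \<le> b * real k" "b < a \<Longrightarrow> b * real k \<le> a * real k"
      by (simp_all add: mult_right_mono)
    with ab show ?thesis
      by (auto simp: z_def I_def min_def max_def field_simps)
  qed
  define A where "A k = {x. ?m x \<noteq> 0} \<inter> I a (z k)" for k
  have A: "A k \<in> sets borel" for k unfolding A_def by measurable
  have "\<exists>k. emeasure lborel (A k) \<noteq> 0"
  proof (rule ccontr)
    assume "\<not> ?thesis"
    then have "(\<Union>k. A k) \<in> null_sets lborel"
      using A by (intro null_sets_UN) (auto simp: null_sets_def)
    moreover have "{x \<in> space lborel. \<not> ?m x = 0} \<subseteq> (\<Union>k. A k)"
    proof safe
      fix x assume "?m x \<noteq> 0"
      with outside have x: "x \<in> I a b" by blast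
      then have "0 < \<bar>b - x\<bar> / \<bar>b - a\<bar>" using I_distinct by fastforce
      then obtain k where k: "inverse (real (Suc k)) < \<bar>b - x\<bar> / \<bar>b - a\<bar>"
        using reals_Archimedean by blast
      have "inverse (real (k + 2)) \<le> inverse (real (Suc k))"
        by (intro le_imp_inverse_le) auto
      with k have "inverse (real (k + 2)) < \<bar>b - x\<bar> / \<bar>b - a\<bar>" by linarith
      then have "\<bar>b - a\<bar> / real (k + 2) < \<bar>b - x\<bar>"
        using ab by (simp add: field_simps)
      then have "\<bar>b - z k\<bar> < \<bar>b - x\<bar>"
        by (simp add: z_def)
      with x z[of k] have "x \<in> I a (z k)"
        by (auto simp: I_def min_def max_def split: if_splits)
      with \<open>?m x \<noteq> 0\<close> show "x \<in> (\<Union>k. A k)" by (auto simp: A_def)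
    qed
    ultimately have "AE x in lborel. ?m x = 0"
      by (rule AE_I')
    then have "(\<integral>\<^sup>+x. ?m x \<partial>lborel) = 0"
      by (simp add: nn_integral_0_iff_AE del: One_nat_def)
    then show False
      using nn_integral_marginal[of L n a b 1, OF meas] density_familyD(3)[OF L n ab] n by simp
  qed
  then obtain k where "emeasure lborel (A k) \<noteq> 0" by blast
  then show ?thesis
    by (intro that[OF z A]) (auto simp: A_def)
qed

text \<open>
  Mass of the first marginal makes the last one nonzero near \<open>b\<close>, which makes the first one nonzero
  everywhere, which makes the last one nonzero everywhere.
\<close>

lemma end_marginals_nonzero:
  assumes L: "density_family L" "two_sided_Markov L" "positive_on_paths L n"
    and n: "n \<ge> 1" and ab: "a > 0" "b > 0" "a \<noteq> b"
    and x: "x \<in> I a b"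
  shows "marginal L (Suc n) 1 a b x \<noteq> 0" "marginal L (Suc n) (Suc n) a b x \<noteq> 0"
proof -
  obtain z A where A: "z \<in> I a b" "A \<in> sets borel" "A \<subseteq> I a z" "emeasure lborel A \<noteq> 0"
    "\<And>x. x \<in> A \<Longrightarrow> marginal L (Suc n) 1 a b x \<noteq> 0"
    using first_marginal_support_mass[OF L(1) _ ab, of "Suc n"] by (metis le_add1 plus_1_eq_Suc)
  have last: "marginal L (Suc n) (Suc n) a b y \<noteq> 0" if "y \<in> I z b" for y
    by (rule last_marginal_nonzero[OF L n ab A(2,4,3,5,1) that])
  have first: "marginal L (Suc n) 1 a b x \<noteq> 0" if x: "x \<in> I a b" for x
  proof -
    \<comment> \<open>A point that comes after \<open>x\<close> and not before \<open>z\<close>.\<close>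
    obtain w where w: "w \<in> I a b" "x \<in> I a w" "I w b \<subseteq> I z b"
    proof
      let ?w = "if x \<in> I a z then z else (x + b) / 2"
      show "?w \<in> I a b" "x \<in> I a ?w" "I ?w b \<subseteq> I z b"
        using x A(1) by (auto simp: I_def min_def max_def split: if_splits)
    qed
    show ?thesis
      using first_marginal_nonzero[OF L n ab w(1) _ w(2)] last w(3) by blast
  qed
  then show "marginal L (Suc n) 1 a b x \<noteq> 0" using x .
  \<comment> \<open>Any point between \<open>a\<close> and \<open>x\<close> can now play the role of \<open>z\<close>, with a whole interval as \<open>A\<close>.\<close>
  let ?z = "(a + x) / 2"
  have z: "?z \<in> I a b" "x \<in> I ?z b"
    using x I_exchange I_midpoint I_distinct by metis+
  show "marginal L (Suc n) (Suc n) a b x \<noteq> 0"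
  proof (rule last_marginal_nonzero[OF L n ab _ _ order_refl _ z])
    show "emeasure lborel (I a ?z) \<noteq> 0"
      using z(1) emeasure_I I_distinct by metis
    show "marginal L (Suc n) 1 a b x' \<noteq> 0" if "x' \<in> I a ?z" for x'
      using that first z(1) I_exchange by blast
  qed simp
qed

text \<open>
  Positivity in dimension \<open>n\<close> is what makes the end marginals in dimension \<open>n + 1\<close> nonzero; positivity
  then passes to dimension \<open>n + 1\<close> through the factorisation at the first coordinate, because a path
  without its first point is again a path.
\<close>

lemma all_positive_on_paths:
  assumes L: "density_family L" "two_sided_Markov L" and "n \<ge> 1"
  shows "positive_on_paths L n"
  using \<open>n \<ge> 1\<close>
proof (induction n rule: dec_induct)
  case base
  show ?case
    unfolding positive_on_paths_def
  proof (intro allI impI ballI)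
    fix a b :: real and \<theta> assume ab: "a > 0" "b > 0" "a \<noteq> b" and "\<theta> \<in> path 1 a b"
    then have \<theta>: "\<theta> \<in> extensional {1}" "\<theta> 1 \<in> I a b" by (auto simp: path_def PiE_def)
    have "supp (\<lambda>t. L 1 a b (\<lambda>i\<in>{1}. t)) = I a b"
      using L(2) ab unfolding two_sided_Markov_def by blast
    then have "L 1 a b (\<lambda>i\<in>{1}. \<theta> 1) \<noteq> 0"
      using \<theta>(2) by (auto simp: supp_def)
    moreover have "(\<lambda>i\<in>{1}. \<theta> 1) = \<theta>"
      using \<theta>(1) by (auto simp: extensional_def)
    ultimately have "L 1 a b \<theta> \<noteq> 0" by simp
    with density_familyD(2)[OF L(1) order_refl ab, of \<theta>] \<theta>(1) show "0 < L 1 a b \<theta>" by auto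
  qed
next
  case (step n)
  show ?case
    unfolding positive_on_paths_def
  proof (intro allI impI ballI)
    fix a b :: real and \<theta> assume ab: "a > 0" "b > 0" "a \<noteq> b" and p: "\<theta> \<in> path (Suc n) a b"
    then have \<theta>: "\<theta> \<in> {1..Suc n} \<rightarrow>\<^sub>E I a b" by (simp add: path_def)
    then have 1: "\<theta> 1 \<in> I a b" by (auto simp: PiE_def)
    have "0 < L n (\<theta> 1) b (\<lambda>i\<in>{1..n}. \<theta> (1 + i))"
      using step.IH path_tail[OF p] 1 I_pos I_distinct ab unfolding positive_on_paths_def by metis
    then show "0 < L (Suc n) a b \<theta>"
      using factor_first[OF L step.IH step.hyps(1) ab \<theta>]
        end_marginals_nonzero(1)[OF L step.IH step.hyps(1) ab 1] by (metis mult_pos_pos)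
  qed
qed

section \<open>The quotient of two families\<close>

text \<open>
  The factors \<open>K\<close> and \<open>J\<close> below are common to both families by \<open>eq\<close>, so the quotient of the two
  densities equals \<open>m' / m\<close> at the first and \<open>q' / q\<close> at the last coordinate.
\<close>

lemma dimension_step:
  assumes L: "density_family L" "two_sided_Markov L"
    and L': "density_family L'" "two_sided_Markov L'"
    and n: "n \<ge> 1" and ab: "a > 0" "b > 0" "a \<noteq> b"
    and eq: "\<And>a b \<theta>. a > 0 \<Longrightarrow> b > 0 \<Longrightarrow> a \<noteq> b \<Longrightarrow> \<theta> \<in> extensional {1..n} \<Longrightarrow> L n a b \<theta> = L' n a b \<theta>"
    and ext: "\<theta> \<in> extensional {1..Suc n}"
  shows "L (Suc n) a b \<theta> = L' (Suc n) a b \<theta>"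
proof -
  note P = all_positive_on_paths[OF L n] and P' = all_positive_on_paths[OF L' n]
  define m m' where "m x = enn2real (marginal L (Suc n) 1 a b x)"
    and "m' x = enn2real (marginal L' (Suc n) 1 a b x)" for x
  define q q' where "q y = enn2real (marginal L (Suc n) (Suc n) a b y)"
    and "q' y = enn2real (marginal L' (Suc n) (Suc n) a b y)" for y
  define K where "K \<theta> = L n (\<theta> 1) b (\<lambda>i\<in>{1..n}. \<theta> (1 + i))" for \<theta>
  define J where "J \<theta> = L n a (\<theta> (Suc n)) (\<lambda>i\<in>{1..n}. \<theta> i)" for \<theta>
  have factor: "m (\<theta> 1) > 0" "L (Suc n) a b \<theta> = m (\<theta> 1) * K \<theta>"
    "m' (\<theta> 1) > 0" "L' (Suc n) a b \<theta> = m' (\<theta> 1) * K \<theta>"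
    "q (\<theta> (Suc n)) > 0" "L (Suc n) a b \<theta> = q (\<theta> (Suc n)) * J \<theta>"
    "q' (\<theta> (Suc n)) > 0" "L' (Suc n) a b \<theta> = q' (\<theta> (Suc n)) * J \<theta>"
    if \<theta>: "\<theta> \<in> {1..Suc n} \<rightarrow>\<^sub>E I a b" for \<theta>
  proof -
    have I: "\<theta> 1 \<in> I a b" "\<theta> (Suc n) \<in> I a b" using \<theta> by (auto simp: PiE_def)
    then have "\<theta> 1 > 0" "\<theta> 1 \<noteq> b" "\<theta> (Suc n) > 0" "a \<noteq> \<theta> (Suc n)"
      using I_pos I_distinct ab by blast+
    then have KJ: "K \<theta> = L' n (\<theta> 1) b (\<lambda>i\<in>{1..n}. \<theta> (1 + i))"
      "J \<theta> = L' n a (\<theta> (Suc n)) (\<lambda>i\<in>{1..n}. \<theta> i)"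
      unfolding K_def J_def using ab by (intro eq; simp)+
    show "m (\<theta> 1) > 0" "L (Suc n) a b \<theta> = m (\<theta> 1) * K \<theta>"
      using factor_first[OF L P n ab \<theta> end_marginals_nonzero(1)[OF L P n ab I(1)]]
      by (simp_all add: m_def K_def)
    show "m' (\<theta> 1) > 0" "L' (Suc n) a b \<theta> = m' (\<theta> 1) * K \<theta>"
      using factor_first[OF L' P' n ab \<theta> end_marginals_nonzero(1)[OF L' P' n ab I(1)]]
      by (simp_all add: m'_def KJ)
    show "q (\<theta> (Suc n)) > 0" "L (Suc n) a b \<theta> = q (\<theta> (Suc n)) * J \<theta>"
      using factor_last[OF L P n ab \<theta> end_marginals_nonzero(2)[OF L P n ab I(2)]]
      by (simp_all add: q_def J_def)
    show "q' (\<theta> (Suc n)) > 0" "L' (Suc n) a b \<theta> = q' (\<theta> (Suc n)) * J \<theta>"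
      using factor_last[OF L' P' n ab \<theta> end_marginals_nonzero(2)[OF L' P' n ab I(2)]]
      by (simp_all add: q'_def KJ)
  qed
  have ratio: "m' x / m x = q' y / q y" if xy: "x \<in> I a b" "y \<in> I x b" for x y
  proof -
    obtain \<theta> where \<theta>: "\<theta> \<in> path (Suc n) a b" "\<theta> 1 = x" "\<theta> (Suc n) = y"
      using path_exists[OF n xy] by metis
    then have in_I: "\<theta> \<in> {1..Suc n} \<rightarrow>\<^sub>E I a b" by (simp add: path_def)
    have pos: "L (Suc n) a b \<theta> > 0"
      using all_positive_on_paths[OF L, of "Suc n"] \<theta>(1) ab by (simp add: positive_on_paths_def)
    then have KJ: "K \<theta> \<noteq> 0" "J \<theta> \<noteq> 0"
      using factor(2)[OF in_I] factor(6)[OF in_I] by auto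
    have "m' x / m x = L' (Suc n) a b \<theta> / L (Suc n) a b \<theta>"
      using factor(2,4)[OF in_I] KJ \<theta> by simp
    also have "\<dots> = q' y / q y"
      unfolding factor(6,8)[OF in_I] using KJ \<theta> by simp
    finally show ?thesis .
  qed
  \<comment> \<open>Two points \<open>x\<close> are compared through a common later point \<open>y\<close>.\<close>
  define c where "c = m' ((a + b) / 2) / m ((a + b) / 2)"
  have c: "m' x / m x = c" if x: "x \<in> I a b" for x
  proof -
    have "\<exists>y. y \<in> I x b \<and> y \<in> I ((a + b) / 2) b"
      using x by (intro exI[of _ "if x \<in> I a ((a + b) / 2) then ((a + b) / 2 + b) / 2 else (x + b) / 2"])
        (auto simp: I_def min_def max_def field_simps split: if_splits)
    then show ?thesis
      using ratio x I_midpoint[OF ab(3)] unfolding c_def by metis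
  qed
  \<comment> \<open>This holds also off the paths, where \<open>K\<close> may be 0.\<close>
  have scaled: "L' (Suc n) a b \<theta> = c * L (Suc n) a b \<theta>" if "\<theta> \<in> extensional {1..Suc n}" for \<theta>
  proof (cases "\<theta> \<in> {1..Suc n} \<rightarrow>\<^sub>E I a b")
    case True
    then have "\<theta> 1 \<in> I a b" by (auto simp: PiE_def)
    from c[OF this] have "m' (\<theta> 1) = c * m (\<theta> 1)"
      using factor(1)[OF True] by (simp add: field_simps)
    then show ?thesis using factor(2,4)[OF True] by simp
  next
    case False
    then show ?thesis
      using density_familyD(4)[OF L(1) _ ab _ False] density_familyD(4)[OF L'(1) _ ab _ False] that by simp
  qed
  have c0: "c \<ge> 0" by (simp add: c_def m_def m'_def)
  have "1 = (\<integral>\<^sup>+\<theta>. ennreal (L' (Suc n) a b \<theta>) \<partial>lebesgue_n (Suc n))"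
    using density_familyD(3)[OF L'(1) _ ab, of "Suc n"] by simp
  also have "\<dots> = (\<integral>\<^sup>+\<theta>. ennreal c * ennreal (L (Suc n) a b \<theta>) \<partial>lebesgue_n (Suc n))"
    by (intro nn_integral_cong) (simp add: scaled space_PiM PiE_def c0 ennreal_mult')
  also have "\<dots> = ennreal c"
    using density_familyD(1,3)[OF L(1) _ ab, of "Suc n"] by (subst nn_integral_cmult) auto
  finally have "c = 1" by simp
  with scaled[OF ext] show ?thesis by simp
qed

theorem theorem4p1:
  fixes L L' :: "nat \<Rightarrow> real \<Rightarrow> real \<Rightarrow> (nat \<Rightarrow> real) \<Rightarrow> real"
  assumes "density_family L" and "two_sided_Markov L"
    and "density_family L'" and "two_sided_Markov L'"
    and "\<forall>a>0. \<forall>b>0. a \<noteq> b \<longrightarrow>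
           (\<forall>\<theta>\<in>space (lebesgue_n 1). L 1 a b \<theta> = L' 1 a b \<theta>)"
  shows "\<forall>n\<ge>1. \<forall>a>0. \<forall>b>0. a \<noteq> b \<longrightarrow>
           (\<forall>\<theta>\<in>space (lebesgue_n n). L n a b \<theta> = L' n a b \<theta>)"
proof (intro allI impI)
  have ext: "space (lebesgue_n n) = extensional {1..n}" for n
    by (simp add: space_PiM PiE_def)
  fix n :: nat and a b :: real
  assume "n \<ge> 1" "a > 0" "b > 0" "a \<noteq> b"
  then show "\<forall>\<theta>\<in>space (lebesgue_n n). L n a b \<theta> = L' n a b \<theta>"
  proof (induction n arbitrary: a b rule: dec_induct)
    case base
    then show ?case using assms(5) by blast
  next
    case (step n)
    then show ?case
      using dimension_step[OF assms(1-4) step.hyps(1) step.prems] unfolding ext by blast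
  qed
qed

end
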